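(* For any (real or complex) constants $\alpha,\beta$ and $\eta$, $$\frac{1}{\alpha+\beta+1}\Bigl[\sinh(\eta x^\beta)\;{}_1F_2\Bigl(1; \frac{\alpha+\beta+1}{2\beta}, \frac{\alpha+2\beta+1}{2\beta}; \frac{\eta^2 x^{2\beta}}{4}\Bigr)- \beta\eta x^{\beta}\cosh(\eta x^\beta)\;{}_1F_2\Bigl(1; \frac{\alpha+2\beta+1}{2\beta}, \frac{\alpha+3\beta+1}{2\beta}; \frac{\eta^2 x^{2\beta}}{4}\Bigr)\Bigr]$$ $$=\frac{1}{2}\Bigl[e^{\eta x^\beta}\;{}_1F_1\Bigl(1;\frac{\alpha+\beta+1}{\beta}; -\eta x^{\beta}\Bigr)-e^{-\eta x^\beta}\;{}_1F_1\Bigl(1;\frac{\alpha+\beta+1}{\beta}; \eta x^{\beta}\Bigr)\Bigr].$$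
   Context: ${}_1F_1(a;b;x)=\sum_{n=0}^{\infty}\frac{(a)_n}{(b)_n}\frac{x^n}{n!}$ and ${}_1F_2(a;b,c;x)=\sum_{n=0}^{\infty}\frac{(a)_n}{(b)_n(c)_n}\frac{x^n}{n!}$, where $(\vartheta)_n=\Gamma(\vartheta+n)/\Gamma(\vartheta)$, $(\vartheta)_0=1$ (Pochhammer symbol). The identity is an identity in the variable $x$.
   Formalization: The printed identity is false (e.g. α=0, β=2, η=x=1); the proved one multiplies the sinh term in the bracket by the missing factor α+β+1, and assumes β≠0 and (α+β+1)/β not in {0,−1,−2,…} so that the series are defined. *)

theory Defs
  imports "HOL-Analysis.Analysis"
begin

text \<open>
  The series are used only at lower parameters outside \<open>\<int>\<^sub>\<le>\<^sub>0\<close>. For other lower parameters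
  the quotients are not meaningful: division by zero is \<open>0\<close>.
\<close>

definition hyp1F1 :: "complex \<Rightarrow> complex \<Rightarrow> complex \<Rightarrow> complex" where
  "hyp1F1 a b x = (\<Sum>n. pochhammer a n / pochhammer b n * (x ^ n / fact n))"

definition hyp1F2 :: "complex \<Rightarrow> complex \<Rightarrow> complex \<Rightarrow> complex \<Rightarrow> complex" where
  "hyp1F2 a b c x = (\<Sum>n. pochhammer a n / (pochhammer b n * pochhammer c n) * (x ^ n / fact n))"

text \<open>
  Let \<open>y = \<eta> x\<^sup>\<beta>\<close>, and let \<open>F\<close>, \<open>G\<close> be the two \<open>\<^sub>1F\<^sub>2\<close> values in the identity for constants
  \<open>\<alpha>\<close>, \<open>\<beta>\<close>, \<open>\<eta>\<close>. In print, its left-hand side is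
  \<open>1 / (\<alpha> + \<beta> + 1) * (sinh y * F - \<beta> * y * cosh y * G)\<close>, which lacks a factor \<open>\<alpha> + \<beta> + 1\<close> on the
  \<open>sinh\<close> term: the coefficient of \<open>y\<close> is \<open>(1 - \<beta>) / (\<alpha> + \<beta> + 1)\<close> on the left but
  \<open>(\<alpha> + 1) / (\<alpha> + \<beta> + 1)\<close> on the right, so the printed form is false unless \<open>\<alpha> + \<beta> = 0\<close>.
  The identity with that factor restored is the one that is stated.

  If \<open>(\<alpha> + \<beta> + 1) / \<beta>\<close> is not in \<open>\<int>\<^sub>\<le>\<^sub>0\<close>, then \<open>\<alpha> + \<beta> + 1 \<noteq> 0\<close>, and none of the \<open>\<^sub>1F\<^sub>2\<close> parameters
  \<open>(\<alpha> + k * \<beta> + 1) / (2 * \<beta>)\<close>, for \<open>k = 1, 2, 3\<close>, is in \<open>\<int>\<^sub>\<le>\<^sub>0\<close> either.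

  For complex arguments \<open>x powr \<beta>\<close> is the principal branch, with \<open>0 powr \<beta> = 0\<close>.
\<close>

end

theory Submission
  imports Defs
begin

text \<open>
  Since \<open>(1)\<^sub>n = n!\<close>, the series \<open>\<^sub>1F\<^sub>1(1; c; y)\<close> is the sum of \<open>y\<^sup>n / (c)\<^sub>n\<close>. By the duplication
  formula \<open>(c)\<^sub>2\<^sub>n = 4\<^sup>n (c/2)\<^sub>n ((c+1)/2)\<^sub>n\<close> its even part is \<open>F = \<^sub>1F\<^sub>2(1; c/2, (c+1)/2; y\<^sup>2/4)\<close>, and
  by \<open>(c)\<^sub>2\<^sub>n\<^sub>+\<^sub>1 = c (c+1)\<^sub>2\<^sub>n\<close> its odd part is \<open>(y/c) G\<close> with \<open>G = \<^sub>1F\<^sub>2(1; (c+1)/2, (c+2)/2; y\<^sup>2/4)\<close>.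
  For \<open>c = (\<alpha> + \<beta> + 1) / \<beta>\<close> both sides of the identity equal \<open>F sinh y - (y/c) G cosh y\<close>.
\<close>

lemma hyp1F1_one: "hyp1F1 1 c y = (\<Sum>n. y ^ n / pochhammer c n)"
  by (simp add: hyp1F1_def flip: pochhammer_fact)

lemma hyp1F2_one: "hyp1F2 1 b c y = (\<Sum>n. y ^ n / (pochhammer b n * pochhammer c n))"
  by (simp add: hyp1F2_def flip: pochhammer_fact)

text \<open>Ratio test: consecutive terms differ by the factor \<open>y / (c + of_nat n)\<close>,
  which tends to 0. If \<open>c + of_nat n = 0\<close> for some \<open>n\<close>, all later terms
  are 0, since division by zero is 0.\<close>

lemma summable_power_div_pochhammer:
  fixes c y :: complex
  shows "summable (\<lambda>n. y ^ n / pochhammer c n)"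
proof -
  have "filterlim (\<lambda>n. c + of_nat n) at_infinity sequentially"
    by (intro tendsto_add_filterlim_at_infinity[OF tendsto_const] tendsto_of_nat)
  then have "(\<lambda>n. y / (c + of_nat n)) \<longlonglongrightarrow> 0"
    by (rule tendsto_divide_0[OF tendsto_const])
  from order_tendstoD(2)[OF tendsto_norm_zero[OF this], of "1/2"]
  have "\<forall>\<^sub>F n in sequentially. norm (y / (c + of_nat n)) < 1/2"
    by simp
  then obtain N where N: "\<And>n. n \<ge> N \<Longrightarrow> norm (y / (c + of_nat n)) < 1/2"
    by (auto simp: eventually_sequentially)
  show ?thesis
  proof (rule summable_ratio_test[where c = "1/2" and N = N])
    fix n assume "n \<ge> N"
    have "y ^ Suc n / pochhammer c (Suc n) = y / (c + of_nat n) * (y ^ n / pochhammer c n)"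
      by (simp add: pochhammer_rec')
    then show "norm (y ^ Suc n / pochhammer c (Suc n)) \<le> 1/2 * norm (y ^ n / pochhammer c n)"
      using mult_right_mono[OF less_imp_le[OF N[OF \<open>n \<ge> N\<close>]], of "norm (y ^ n / pochhammer c n)"]
      by (simp only: norm_mult norm_ge_zero)
  qed simp
qed

text \<open>Replacing \<open>y\<close> by \<open>- y\<close> flips only the second term of each
  pair, so adding or subtracting the two paired series isolates the even or the odd terms.\<close>

lemma hyp1F1_one_pairs_sums:
  "(\<lambda>n. y ^ (2 * n) / pochhammer c (2 * n) + y ^ Suc (2 * n) / pochhammer c (Suc (2 * n)))
     sums hyp1F1 1 c y"
  using sums_group[OF summable_sums[OF summable_power_div_pochhammer[of y c]], of 2]
  by (simp add: hyp1F1_one mult.commute)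

lemma even_term_eq:
  fixes c y :: complex
  shows "y ^ (2 * n) / pochhammer c (2 * n) =
    (y\<^sup>2 / 4) ^ n / (pochhammer (c / 2) n * pochhammer ((c + 1) / 2) n)"
  using pochhammer_double[of "c / 2" n]
  by (simp add: power_mult power_divide add_divide_distrib mult.assoc)

lemma hyp1F1_one_even_part:
  "hyp1F1 1 c y + hyp1F1 1 c (- y) = 2 * hyp1F2 1 (c / 2) ((c + 1) / 2) (y\<^sup>2 / 4)"
proof -
  have *: "(\<lambda>n. 2 * (y ^ (2 * n) / pochhammer c (2 * n))) sums (hyp1F1 1 c y + hyp1F1 1 c (- y))"
    using sums_add[OF hyp1F1_one_pairs_sums[of y c] hyp1F1_one_pairs_sums[of "- y" c]] by simp
  have "(\<lambda>n. y ^ (2 * n) / pochhammer c (2 * n)) sums ((hyp1F1 1 c y + hyp1F1 1 c (- y)) / 2)"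
    using sums_divide[OF *, of 2] by simp
  then have "hyp1F2 1 (c / 2) ((c + 1) / 2) (y\<^sup>2 / 4) = (hyp1F1 1 c y + hyp1F1 1 c (- y)) / 2"
    by (simp only: even_term_eq hyp1F2_one sums_iff)
  then show ?thesis
    by (simp add: mult.commute)
qed

lemma hyp1F1_one_odd_part:
  "hyp1F1 1 c y - hyp1F1 1 c (- y) =
    2 * (y / c * hyp1F2 1 ((c + 1) / 2) ((c + 2) / 2) (y\<^sup>2 / 4))"
proof (cases "y / c = 0")
  case True
  \<comment> \<open>Here \<open>y = 0\<close> or \<open>c = 0\<close>. Either way every odd term is
    0; for \<open>c = 0\<close> because \<open>pochhammer 0 (Suc n) = 0\<close>.\<close>
  then show ?thesis
    using sums_diff[OF hyp1F1_one_pairs_sums[of y c] hyp1F1_one_pairs_sums[of "- y" c]]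
    by (auto simp: pochhammer_rec sums_iff)
next
  case False
  have "(\<lambda>n. 2 * (y ^ Suc (2 * n) / pochhammer c (Suc (2 * n)))) sums
      (hyp1F1 1 c y - hyp1F1 1 c (- y))"
    using sums_diff[OF hyp1F1_one_pairs_sums[of y c] hyp1F1_one_pairs_sums[of "- y" c]] by simp
  then have *: "(\<lambda>n. 2 * (y / c) * (y ^ (2 * n) / pochhammer (c + 1) (2 * n))) sums
      (hyp1F1 1 c y - hyp1F1 1 c (- y))"
    by (simp add: pochhammer_rec mult.assoc)
  \<comment> \<open>Dividing by the nonzero factor \<open>2 * (y / c)\<close> leaves an even series
    with parameter \<open>c + 1\<close>, to which \<open>even_term_eq\<close> applies.\<close>
  have "(\<lambda>n. y ^ (2 * n) / pochhammer (c + 1) (2 * n)) sums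
      ((hyp1F1 1 c y - hyp1F1 1 c (- y)) / (2 * (y / c)))"
    using sums_divide[OF *, of "2 * (y / c)"] False by simp
  then have "hyp1F2 1 ((c + 1) / 2) ((c + 2) / 2) (y\<^sup>2 / 4) =
      (hyp1F1 1 c y - hyp1F1 1 c (- y)) / (2 * (y / c))"
    by (simp only: even_term_eq hyp1F2_one sums_iff add.assoc one_add_one)
  with False show ?thesis
    by (simp add: field_simps)
qed

theorem theorem3:
  fixes \<alpha> \<beta> \<eta> x :: complex
  assumes "\<beta> \<noteq> 0"
    and "(\<alpha> + \<beta> + 1) / \<beta> \<notin> \<int>\<^sub>\<le>\<^sub>0"
  shows "1 / (\<alpha> + \<beta> + 1) *
      ((\<alpha> + \<beta> + 1) * sinh (\<eta> * x powr \<beta>) *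
          hyp1F2 1 ((\<alpha> + \<beta> + 1) / (2 * \<beta>)) ((\<alpha> + 2 * \<beta> + 1) / (2 * \<beta>)) (\<eta>\<^sup>2 * x powr (2 * \<beta>) / 4)
       - \<beta> * \<eta> * x powr \<beta> * cosh (\<eta> * x powr \<beta>) *
          hyp1F2 1 ((\<alpha> + 2 * \<beta> + 1) / (2 * \<beta>)) ((\<alpha> + 3 * \<beta> + 1) / (2 * \<beta>)) (\<eta>\<^sup>2 * x powr (2 * \<beta>) / 4))
    = 1 / 2 *
      (exp (\<eta> * x powr \<beta>) * hyp1F1 1 ((\<alpha> + \<beta> + 1) / \<beta>) (- (\<eta> * x powr \<beta>))
       - exp (- (\<eta> * x powr \<beta>)) * hyp1F1 1 ((\<alpha> + \<beta> + 1) / \<beta>) (\<eta> * x powr \<beta>))"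
proof -
  define c where "c = (\<alpha> + \<beta> + 1) / \<beta>"
  define y where "y = \<eta> * x powr \<beta>"
  define F where "F = hyp1F2 1 (c / 2) ((c + 1) / 2) (y\<^sup>2 / 4)"
  define G where "G = hyp1F2 1 ((c + 1) / 2) ((c + 2) / 2) (y\<^sup>2 / 4)"
  have "c \<noteq> 0"
    using assms(2) by (auto simp: c_def)
  have \<beta>c: "\<alpha> + \<beta> + 1 = \<beta> * c"
    using assms(1) by (simp add: c_def)
  have params: "(\<alpha> + \<beta> + 1) / (2 * \<beta>) = c / 2" "(\<alpha> + 2 * \<beta> + 1) / (2 * \<beta>) = (c + 1) / 2"
    "(\<alpha> + 3 * \<beta> + 1) / (2 * \<beta>) = (c + 2) / 2"
    using assms(1) by (simp_all add: c_def field_simps)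
  \<comment> \<open>Both powers use the same logarithm of \<open>x\<close>, so no branch correction
    arises; at \<open>x = 0\<close> both sides are 0.\<close>
  have "x powr (2 * \<beta>) = (x powr \<beta>)\<^sup>2"
    by (simp only: mult_2 powr_add power2_eq_square)
  then have arg: "\<eta>\<^sup>2 * x powr (2 * \<beta>) / 4 = y\<^sup>2 / 4"
    by (simp add: y_def power_mult_distrib)
  \<comment> \<open>\<open>F\<close> and \<open>t\<close> are the even and odd parts in
    \<open>y\<close> of \<open>hyp1F1 1 c y\<close>.\<close>
  define t where "t = y / c * G"
  have M: "hyp1F1 1 c y = F + t" "hyp1F1 1 c (- y) = F - t"
    using hyp1F1_one_even_part[of c y] hyp1F1_one_odd_part[of c y]
    unfolding F_def [symmetric] G_def [symmetric] t_def [symmetric] by algebra+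
  have "1 / (\<beta> * c) * (\<beta> * c * sinh y * F - \<beta> * y * cosh y * G) = sinh y * F - cosh y * t"
    using assms(1) \<open>c \<noteq> 0\<close> by (simp add: t_def right_diff_distrib)
  \<comment> \<open>Collecting by \<open>F\<close> and \<open>t\<close> gives
    \<open>exp y - exp (- y)\<close> and \<open>exp y + exp (- y)\<close>, twice
    \<open>sinh y\<close> and twice \<open>cosh y\<close>.\<close>
  also have "\<dots> = 1 / 2 * (exp y * (F - t) - exp (- y) * (F + t))"
    by (simp add: sinh_field_def cosh_field_def diff_divide_distrib add_divide_distrib algebra_simps)
  finally have "1 / (\<beta> * c) * (\<beta> * c * sinh y * F - \<beta> * y * cosh y * G) =
      1 / 2 * (exp y * hyp1F1 1 c (- y) - exp (- y) * hyp1F1 1 c y)"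
    by (simp only: M)
  then show ?thesis
    unfolding params arg c_def [symmetric]
    unfolding \<beta>c F_def G_def y_def by (simp only: mult.assoc)
qed

end
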